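(* Let $\mathcal{M}=(\mathcal{A},N,B_0,\theta)$ be any threshold model. Let $\mathcal{M}_n=(\mathcal{A},N,B_n,\theta)$ be the sequence of threshold models given by $$B_{n+1}=B_n\cup\left\{a\in\mathcal{A}:\frac{|N(a)\cap B_n|}{|N(a)|}\geq\theta\right\},\qquad n\ge 0.$$ Let $\mathcal{E}_1$ be the action model with two states $\sigma_1,\sigma_2$, relation $R=\{\sigma_1,\sigma_2\}\times\{\sigma_1,\sigma_2\}$, and $$pre(\sigma_1)=\langle\leq\rangle B,\quad post(\sigma_1)=B,\qquad pre(\sigma_2)=\neg\langle\leq\rangle B,\quad post(\sigma_2)=\top .$$ Let $\mathcal{M}^0=\mathcal{M}$ and $\mathcal{M}^{n+1}=\mathcal{M}^n\otimes\mathcal{E}_1$ (product update). Then the two sequences are step-wise equivalent: for every $n\geq 0$, the threshold models $\mathcal{M}_n$ and $\mathcal{M}^n$ are isomorphic.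
   Context: A threshold model is a tuple $\mathcal{M}=(\mathcal{A},N,B,\theta)$, where $\mathcal{A}$ is a finite set (agents), $N\subseteq\mathcal{A}\times\mathcal{A}$ is irreflexive and symmetric, $B\subseteq\mathcal{A}$ is the set of agents currently playing the behavior $B$, and $\theta\in[0,1]$. Write $N(a)=\{b:(a,b)\in N\}$. Two threshold models $(\mathcal{A},N,B,\theta)$ and $(\mathcal{A}',N',B',\theta)$ with the same threshold are isomorphic if there is a bijection $f:\mathcal{A}\to\mathcal{A}'$ with $(a,b)\in N\Leftrightarrow(f(a),f(b))\in N'$ and $f(B)=B'$. Formulas are built from $\top$ and the atom $B$ using Boolean connectives and threshold modalities, in particular $\langle\leq\rangle$. They are evaluated at agents: $\mathcal{M},a\models B$ iff $a\in B$; Boolean clauses are standard; and $\mathcal{M},a\models\langle\leq\rangle\varphi$ iff there exists a set of agents $C$ with $\theta\leq\frac{|C\cap N(a)|}{|N(a)|}$ such that $\mathcal{M},c\models\varphi$ for all $c\in C$. An action model is a tuple $\mathcal{E}=(|\mathcal{E}|,R,cond)$ with $|\mathcal{E}|$ a non-empty set of states, $R\subseteq|\mathcal{E}|\times|\mathcal{E}|$, and $cond$ assigning to each state $\sigma$ a pair $(pre(\sigma),post(\sigma))$, where $pre(\sigma)$ is a formula and $post(\sigma)\in\{B,\neg B,\top\}$. The product update of $\mathcal{M}=(\mathcal{A},N,B,\theta)$ and $\mathcal{E}$ is $\mathcal{M}\otimes\mathcal{E}=(\mathcal{A}^{\uparrow},N^{\uparrow},B^{\uparrow},\theta)$, where -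 $\mathcal{A}^{\uparrow}=\{(a,\sigma)\in\mathcal{A}\times|\mathcal{E}|:\mathcal{M},a\models pre(\sigma)\}$; - $((a,\sigma),(b,\sigma'))\in N^{\uparrow}$ iff $(a,b)\in N$ and $(\sigma,\sigma')\in R$; - $B^{\uparrow}=\{(a,\sigma)\in\mathcal{A}^{\uparrow}:a\in B\text{ and }post(\sigma)\neq\neg B\}\cup\{(a,\sigma)\in\mathcal{A}^{\uparrow}:post(\sigma)=B\}$. *)

theory Defs
  imports Complex_Main
begin

record 'a threshold_model =
  agents :: "'a set"
  nbr :: "('a \<times> 'a) set"
  adopters :: "'a set"
  threshold :: real

definition is_threshold_model :: "'a threshold_model \<Rightarrow> bool" where
  "is_threshold_model M \<longleftrightarrow>
     finite (agents M) \<and> nbr M \<subseteq> agents M \<times> agents M \<and> irrefl (nbr M) \<and> sym (nbr M) \<and>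
     adopters M \<subseteq> agents M \<and> 0 \<le> threshold M \<and> threshold M \<le> 1"

definition neighbours :: "'a threshold_model \<Rightarrow> 'a \<Rightarrow> 'a set" where
  "neighbours M a = {b. (a, b) \<in> nbr M}"

definition isomorphic :: "'a threshold_model \<Rightarrow> 'b threshold_model \<Rightarrow> bool" where
  "isomorphic M M' \<longleftrightarrow>
     is_threshold_model M \<and> is_threshold_model M' \<and> threshold M = threshold M' \<and>
     (\<exists>f. bij_betw f (agents M) (agents M') \<and>
          (\<forall>a\<in>agents M. \<forall>b\<in>agents M. (a, b) \<in> nbr M \<longleftrightarrow> (f a, f b) \<in> nbr M') \<and>
          f ` adopters M = adopters M')"

text \<open>For an agent without neighbours the quotients below and in \<open>sat\<close> are \<open>0 / 0 = 0\<close>: such an agent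
  reaches the threshold iff the threshold is \<open>0\<close>.\<close>

definition threshold_step :: "'a threshold_model \<Rightarrow> 'a threshold_model" where
  "threshold_step M = M\<lparr>adopters := adopters M \<union>
     {a \<in> agents M. real (card (neighbours M a \<inter> adopters M)) / real (card (neighbours M a))
                      \<ge> threshold M}\<rparr>"

definition threshold_seq :: "'a threshold_model \<Rightarrow> nat \<Rightarrow> 'a threshold_model" where
  "threshold_seq M n = (threshold_step ^^ n) M"

datatype form = Top | AtomB | Neg form | Conj form form | DiaLeq form

primrec sat :: "'a threshold_model \<Rightarrow> 'a \<Rightarrow> form \<Rightarrow> bool" where
  "sat M a Top \<longleftrightarrow> True"
| "sat M a AtomB \<longleftrightarrow> a \<in> adopters M"
| "sat M a (Neg \<phi>) \<longleftrightarrow> \<not> sat M a \<phi>"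
| "sat M a (Conj \<phi> \<psi>) \<longleftrightarrow> sat M a \<phi> \<and> sat M a \<psi>"
| "sat M a (DiaLeq \<phi>) \<longleftrightarrow>
     (\<exists>C\<subseteq>agents M.
        threshold M \<le> real (card (C \<inter> neighbours M a)) / real (card (neighbours M a)) \<and>
        (\<forall>c\<in>C. sat M c \<phi>))"

record 's action_model =
  states :: "'s set"
  rel :: "('s \<times> 's) set"
  pre :: "'s \<Rightarrow> form"
  post :: "'s \<Rightarrow> form"

definition is_action_model :: "'s action_model \<Rightarrow> bool" where
  "is_action_model E \<longleftrightarrow>
     states E \<noteq> {} \<and> rel E \<subseteq> states E \<times> states E \<and>
     (\<forall>\<sigma>\<in>states E. post E \<sigma> \<in> {AtomB, Neg AtomB, Top})"

definition updated_agents :: "'a threshold_model \<Rightarrow> 's action_model \<Rightarrow> ('a \<times> 's) set" where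
  "updated_agents M E = {(a, \<sigma>). a \<in> agents M \<and> \<sigma> \<in> states E \<and> sat M a (pre E \<sigma>)}"

definition product_update ::
    "'a threshold_model \<Rightarrow> 's action_model \<Rightarrow> ('a \<times> 's) threshold_model" where
  "product_update M E = \<lparr>
     agents = updated_agents M E,
     nbr = {((a, \<sigma>), (b, \<sigma>')). (a, \<sigma>) \<in> updated_agents M E \<and> (b, \<sigma>') \<in> updated_agents M E \<and>
                               (a, b) \<in> nbr M \<and> (\<sigma>, \<sigma>') \<in> rel E},
     adopters = {(a, \<sigma>) \<in> updated_agents M E. a \<in> adopters M \<and> post E \<sigma> \<noteq> Neg AtomB} \<union>
                {(a, \<sigma>) \<in> updated_agents M E. post E \<sigma> = AtomB},
     threshold = threshold M\<rparr>"

text \<open>Each product update changes the type of agents from \<open>'a\<close> to \<open>'a \<times> 's\<close>. To iterate it a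
  variable number of times, the agents \<open>(\<dots>((a, \<sigma>\<^sub>1), \<sigma>\<^sub>2), \<dots>, \<sigma>\<^sub>n)\<close> of all stages are collected
  in one datatype whose constructors only inject agents and pairs into the common type.\<close>

datatype ('a, 's) stage_agent = Initial 'a | Updated "('a, 's) stage_agent \<times> 's"

definition relabel :: "('a \<Rightarrow> 'b) \<Rightarrow> 'a threshold_model \<Rightarrow> 'b threshold_model" where
  "relabel f M = \<lparr>agents = f ` agents M, nbr = map_prod f f ` nbr M,
                  adopters = f ` adopters M, threshold = threshold M\<rparr>"

primrec iterated_update ::
    "'a threshold_model \<Rightarrow> 's action_model \<Rightarrow> nat \<Rightarrow> ('a, 's) stage_agent threshold_model" where
  "iterated_update M E 0 = relabel Initial M"
| "iterated_update M E (Suc n) = relabel Updated (product_update (iterated_update M E n) E)"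

lemma isomorphic_relabel:
  assumes M: "is_threshold_model M" and f: "inj f"
  shows "isomorphic M (relabel f M)"
proof -
  have nbr: "(f a, f b) \<in> map_prod f f ` nbr M \<longleftrightarrow> (a, b) \<in> nbr M" for a b
    using f by (auto simp: inj_eq)
  have "is_threshold_model (relabel f M)"
    using M f unfolding is_threshold_model_def relabel_def irrefl_def sym_def
    by (auto simp: inj_eq)
  moreover have "bij_betw f (agents M) (f ` agents M)"
    using f by (meson bij_betw_imageI inj_on_subset subset_UNIV)
  ultimately show ?thesis
    using M unfolding isomorphic_def by (intro conjI exI[of _ f]) (simp_all add: relabel_def nbr)
qed

datatype E1_state = Sigma1 | Sigma2

definition E1 :: "E1_state action_model" where
  "E1 = \<lparr>
     states = {Sigma1, Sigma2},
     rel = {Sigma1, Sigma2} \<times> {Sigma1, Sigma2},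
     pre = (\<lambda>\<sigma>. case \<sigma> of Sigma1 \<Rightarrow> DiaLeq AtomB | Sigma2 \<Rightarrow> Neg (DiaLeq AtomB)),
     post = (\<lambda>\<sigma>. case \<sigma> of Sigma1 \<Rightarrow> AtomB | Sigma2 \<Rightarrow> Top)\<rparr>"

lemma is_action_model_E1: "is_action_model E1"
  by (auto simp: is_action_model_def E1_def)

end

theory Submission
  imports Defs
begin

text \<open>The preconditions of the two states of \<open>E1\<close> are complementary, so every agent has exactly one
  copy in the product update: \<open>(a, Sigma1)\<close> if \<open>a\<close> reaches the threshold, and \<open>(a, Sigma2)\<close>
  otherwise. The copies marked \<open>Sigma1\<close> are exactly those that are made to adopt, hence updating with
  \<open>E1\<close> is one threshold step up to isomorphism. As threshold steps respect isomorphism, induction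
  on the number of steps finishes the argument.\<close>

text \<open>Common form of the rule in \<open>threshold_step\<close> and of the precondition of
  \<open>Sigma1\<close>, so that the two can be compared.\<close>

definition reaches_threshold :: "'a threshold_model \<Rightarrow> 'a \<Rightarrow> bool" where
  "reaches_threshold M a \<longleftrightarrow>
     threshold M \<le> real (card (neighbours M a \<inter> adopters M)) / real (card (neighbours M a))"

lemma threshold_step_simps [simp]:
  "agents (threshold_step M) = agents M"
  "nbr (threshold_step M) = nbr M"
  "threshold (threshold_step M) = threshold M"
  "adopters (threshold_step M) = adopters M \<union> {a \<in> agents M. reaches_threshold M a}"
  by (auto simp: threshold_step_def reaches_threshold_def)

lemma neighbours_subset:
  assumes "is_threshold_model M"
  shows "neighbours M a \<subseteq> agents M"
  using assms by (auto simp: is_threshold_model_def neighbours_def)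

lemma finite_neighbours:
  assumes "is_threshold_model M"
  shows "finite (neighbours M a)"
  using finite_subset [OF neighbours_subset [OF assms]] assms
  by (simp add: is_threshold_model_def)

lemma is_threshold_model_threshold_step:
  assumes "is_threshold_model M"
  shows "is_threshold_model (threshold_step M)"
  using assms by (auto simp: is_threshold_model_def)

text \<open>Irreflexivity is inherited from the first components, even where \<open>rel E\<close>
  has loops. Finiteness and symmetry are not part of \<open>is_action_model\<close>, hence the
  assumptions on \<open>E\<close>.\<close>

lemma is_threshold_model_product_update:
  assumes M: "is_threshold_model M" and fin: "finite (states E)" and sym: "sym (rel E)"
  shows "is_threshold_model (product_update M E)"
proof -
  have "updated_agents M E \<subseteq> agents M \<times> states E"
    by (auto simp: updated_agents_def)
  then have "finite (updated_agents M E)"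
    by (rule finite_subset) (use M fin in \<open>simp add: is_threshold_model_def\<close>)
  then show ?thesis
    using M sym by (auto simp: is_threshold_model_def product_update_def irrefl_def sym_def)
qed

text \<open>Every witness \<open>C\<close> for the modality consists of adopters, so
  \<open>adopters M\<close> is itself the largest candidate and suffices as witness.\<close>

lemma sat_DiaLeq_AtomB:
  assumes "is_threshold_model M"
  shows "sat M a (DiaLeq AtomB) \<longleftrightarrow> reaches_threshold M a"
proof
  assume "sat M a (DiaLeq AtomB)"
  then obtain C where
    C: "threshold M \<le> real (card (C \<inter> neighbours M a)) / real (card (neighbours M a))"
    and "\<forall>c\<in>C. c \<in> adopters M"
    by auto
  then have "card (C \<inter> neighbours M a) \<le> card (neighbours M a \<inter> adopters M)"
    by (intro card_mono) (auto simp: finite_neighbours [OF assms])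
  \<comment> \<open>Monotone also for an agent without neighbours, where both quotients are
    0.\<close>
  then have "real (card (C \<inter> neighbours M a)) / real (card (neighbours M a))
      \<le> real (card (neighbours M a \<inter> adopters M)) / real (card (neighbours M a))"
    by (simp add: divide_right_mono)
  with C show "reaches_threshold M a"
    by (simp add: reaches_threshold_def)
next
  assume "reaches_threshold M a"
  moreover have "adopters M \<subseteq> agents M"
    using assms by (simp add: is_threshold_model_def)
  ultimately show "sat M a (DiaLeq AtomB)"
    unfolding sat.simps by (intro exI [of _ "adopters M"])
      (simp add: reaches_threshold_def Int_commute)
qed

lemma isomorphic_trans [trans]:
  assumes "isomorphic M M'" and "isomorphic M' M''"
  shows "isomorphic M M''"
proof -
  obtain f where f: "bij_betw f (agents M) (agents M')"
      "\<forall>a\<in>agents M. \<forall>b\<in>agents M. (a, b) \<in> nbr M \<longleftrightarrow> (f a, f b) \<in> nbr M'"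
      "f ` adopters M = adopters M'"
    using assms(1) unfolding isomorphic_def by blast
  obtain g where g: "bij_betw g (agents M') (agents M'')"
      "\<forall>a\<in>agents M'. \<forall>b\<in>agents M'. (a, b) \<in> nbr M' \<longleftrightarrow> (g a, g b) \<in> nbr M''"
      "g ` adopters M' = adopters M''"
    using assms(2) unfolding isomorphic_def by blast
  have "f a \<in> agents M'" if "a \<in> agents M" for a
    using f(1) that by (rule bij_betwE [rule_format])
  then have "\<forall>a\<in>agents M. \<forall>b\<in>agents M. (a, b) \<in> nbr M \<longleftrightarrow> ((g \<circ> f) a, (g \<circ> f) b) \<in> nbr M''"
    using f(2) g(2) by simp
  moreover have "bij_betw (g \<circ> f) (agents M) (agents M'')"
    using f(1) g(1) by (rule bij_betw_trans)
  moreover have "(g \<circ> f) ` adopters M = adopters M''"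
    by (simp add: image_comp [symmetric] f(3) g(3) del: o_apply)
  ultimately show ?thesis
    using assms unfolding isomorphic_def by (intro conjI exI [of _ "g \<circ> f"]) simp_all
qed

text \<open>The same bijection works: it carries neighbourhoods onto neighbourhoods and, being
  injective on agents, preserves both cardinalities in the quotient.\<close>

lemma isomorphic_threshold_step:
  assumes "isomorphic M M'"
  shows "isomorphic (threshold_step M) (threshold_step M')"
proof -
  have M: "is_threshold_model M" and M': "is_threshold_model M'"
    and thr: "threshold M = threshold M'"
    using assms by (simp_all add: isomorphic_def)
  obtain f where bij: "bij_betw f (agents M) (agents M')"
    and nbr: "\<forall>a\<in>agents M. \<forall>b\<in>agents M. (a, b) \<in> nbr M \<longleftrightarrow> (f a, f b) \<in> nbr M'"
    and adopt: "f ` adopters M = adopters M'"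
    using assms unfolding isomorphic_def by blast
  have inj: "inj_on f (agents M)" and img: "f ` agents M = agents M'"
    using bij by (simp_all add: bij_betw_def)
  have sub: "adopters M \<subseteq> agents M"
    using M by (simp add: is_threshold_model_def)
  have reaches: "reaches_threshold M' (f a) \<longleftrightarrow> reaches_threshold M a" if a: "a \<in> agents M" for a
  proof -
    \<comment> \<open>The equivalence \<open>nbr\<close> holds for agents only, so each neighbour is
      first shown to be an agent or the image of one.\<close>
    have N: "neighbours M' (f a) = f ` neighbours M a"
    proof (intro subset_antisym subsetI)
      fix b' assume b': "b' \<in> neighbours M' (f a)"
      then obtain b where "b \<in> agents M" "b' = f b"
        using neighbours_subset [OF M', of "f a"] by (auto simp: img [symmetric])
      then show "b' \<in> f ` neighbours M a"
        using a b' nbr by (simp add: neighbours_def)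
    next
      fix b' assume "b' \<in> f ` neighbours M a"
      then obtain b where "b \<in> neighbours M a" "b' = f b"
        by blast
      moreover from this have "b \<in> agents M"
        using neighbours_subset [OF M] by blast
      ultimately show "b' \<in> neighbours M' (f a)"
        using a nbr by (simp add: neighbours_def)
    qed
    have NB: "neighbours M' (f a) \<inter> adopters M' = f ` (neighbours M a \<inter> adopters M)"
      using inj_on_image_Int [OF inj neighbours_subset [OF M] sub] N adopt by simp
    have "card (f ` X) = card X" if "X \<subseteq> agents M" for X
      using inj_on_subset [OF inj that] by (rule card_image)
    then show ?thesis
      using neighbours_subset [OF M, of a] sub
      by (simp add: reaches_threshold_def NB le_infI1 thr) (simp add: N)
  qed
  have "f ` {a \<in> agents M. reaches_threshold M a} = {a \<in> agents M'. reaches_threshold M' a}"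
    using reaches by (auto simp: img [symmetric])
  then have "f ` adopters (threshold_step M) = adopters (threshold_step M')"
    by (simp add: image_Un adopt)
  then show ?thesis
    using M M' thr bij nbr unfolding isomorphic_def
    by (intro conjI exI [of _ f])
      (simp_all add: is_threshold_model_threshold_step del: threshold_step_simps(4))
qed

lemma isomorphic_product_update_E1:
  assumes M: "is_threshold_model M"
  shows "isomorphic (threshold_step M) (product_update M E1)"
proof -
  define f where "f a = (a, if reaches_threshold M a then Sigma1 else Sigma2)" for a
  \<comment> \<open>\<open>DiaLeq\<close> stays folded so that \<open>sat_DiaLeq_AtomB\<close> can
    turn both preconditions into \<open>reaches_threshold\<close> and its negation.\<close>
  have upd: "updated_agents M E1 = f ` agents M"
    by (auto simp: updated_agents_def E1_def f_def sat_DiaLeq_AtomB [OF M]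
        simp del: sat.simps(5) split: if_splits)
  have inj: "inj_on f A" for A
    by (simp add: f_def inj_on_def)
  have sub: "adopters M \<subseteq> agents M"
    using M by (simp add: is_threshold_model_def)
  have "is_threshold_model (product_update M E1)"
    using M by (rule is_threshold_model_product_update) (auto simp: E1_def sym_def)
  moreover have "bij_betw f (agents (threshold_step M)) (agents (product_update M E1))"
    by (simp add: product_update_def upd bij_betw_def inj)
  \<comment> \<open>All pairs of states are related in \<open>E1\<close>, so only the first
    components decide adjacency.\<close>
  moreover have "(a, b) \<in> nbr (threshold_step M) \<longleftrightarrow> (f a, f b) \<in> nbr (product_update M E1)"
    if "a \<in> agents M" "b \<in> agents M" for a b
    using that by (auto simp: product_update_def upd) (auto simp: f_def E1_def)
  moreover have "f ` adopters (threshold_step M) = adopters (product_update M E1)"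
  proof -
    \<comment> \<open>No state of \<open>E1\<close> withdraws the behavior: old adopters keep it in
      either copy, and \<open>Sigma1\<close> alone adds new ones.\<close>
    have "post E1 \<sigma> \<noteq> Neg AtomB" "post E1 \<sigma> = AtomB \<longleftrightarrow> \<sigma> = Sigma1" for \<sigma>
      by (cases \<sigma>; simp add: E1_def)+
    then have "adopters (product_update M E1) =
        {(a, \<sigma>) \<in> f ` agents M. a \<in> adopters M \<or> \<sigma> = Sigma1}"
      unfolding product_update_def upd by auto
    then show ?thesis
      using sub by (auto simp: f_def split: if_splits)
  qed
  ultimately show ?thesis
    using is_threshold_model_threshold_step [OF M] unfolding isomorphic_def
    by (intro conjI exI [of _ f]) (simp_all add: product_update_def del: threshold_step_simps(4))
qed

theorem proposition1:
  fixes M :: "'a threshold_model" and n :: nat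
  assumes "is_threshold_model M"
  shows "isomorphic (threshold_seq M n) (iterated_update M E1 n)"
proof (induction n)
  case 0
  show ?case
    using isomorphic_relabel [OF assms, of Initial] by (simp add: threshold_seq_def inj_def)
next
  case (Suc n)
  let ?K = "iterated_update M E1 n"
  have K: "is_threshold_model ?K"
    using Suc by (simp add: isomorphic_def)
  have "isomorphic (threshold_seq M (Suc n)) (threshold_step ?K)"
    using isomorphic_threshold_step [OF Suc] by (simp add: threshold_seq_def)
  also have "isomorphic (threshold_step ?K) (product_update ?K E1)"
    using K by (rule isomorphic_product_update_E1)
  \<comment> \<open>The next stage is this product with its agents injected by
    \<open>Updated\<close> into the common type, which is an isomorphism by
    \<open>isomorphic_relabel\<close>.\<close>
  also have "isomorphic (product_update ?K E1) (iterated_update M E1 (Suc n))"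
    using isomorphic_relabel [of "product_update ?K E1" Updated] isomorphic_product_update_E1 [OF K]
    by (simp add: isomorphic_def inj_def)
  finally show ?case .
qed

end
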